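(* Let $0<\gamma\le1$, $\alpha\in\mathbb{R}$, $0<T\le1$, $0<\sigma<1$, $\beta>0$, and suppose that $H\in Z\hat C^{\gamma}(\Delta_T^3;B_\alpha)$ satisfies the parabolic tail condition with parameters $(\beta,\sigma,K)$. Put $\rho:=\sigma\beta/2$ and $\eta:=\min\{1-\sigma,\rho\}>0$. Then there is a constant $C$ (independent of $H$, $K$ and of the dyadic interval) such that the heat spectral splitting satisfies, for every dyadic parent interval $[a,c]$ of length $L=c-a$ with midpoint $b$ and residual $Q_{ca}$ generated by the recursion, $$\max\{\|Q_{cb}\|_{H^\alpha},\|Q_{ba}\|_{H^\alpha}\}\le\Bigl(\tfrac12+CL^\eta\Bigr)\|Q_{ca}\|_{H^\alpha}+C\bigl(\|H\|_{\gamma,\alpha}+K\bigr)L^\gamma.$$ In particular, at $\gamma=1$ this is a critical admissible scale splitting. If $0<\gamma<1$, then after restricting to a sufficiently small time horizon $T_0$, namely such that $1/2+CT_0^\eta<2^{-\gamma}$, it is a subcritical admissible scale splitting.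
   Context: Let $\mathbb T^d$ be the $d$-dimensional torus, $A_0:=1-\Delta$, $S_t:=e^{-tA_0}$, $B_\alpha:=H^\alpha(\mathbb T^d)$ with $\|x\|_{B_\alpha}=\|x\|_{H^\alpha}:=\|A_0^{\alpha/2}x\|_{L^2}$. $P_{\le N}$ is the $L^2$-orthogonal spectral projection of $A_0$ onto spectral parameters $\lambda\lesssim N^2$ (i.e. $\lambda\le c_0N^2$ for a fixed constant $c_0>0$), $P_{>N}:=\mathrm{Id}-P_{\le N}$, and $N_h:=h^{-\sigma/2}$ for $0<h\le1$. $S_h^{-1}P_{\le N_h}$ is defined spectrally on the finite-dimensional range of $P_{\le N_h}$. $\Delta_T^n:=\{(t_1,\dots,t_n)\in[0,T]^n:0\le t_n\le\dots\le t_1\le T\}$; $C(\Delta_T^n;B_\alpha)$ denotes continuous maps; $(\hat\delta g)_{t_1\dots t_{n+1}}:=\sum_{i=1}^{n+1}(-1)^ig_{t_1\dots\hat t_i\dots t_{n+1}}-(S_{t_1-t_2}-\mathrm{Id})g_{t_2\dots t_{n+1}}$. For $h\in C(\Delta_T^3;B_\alpha)$: $\|h\|_{\gamma,\alpha}:=\inf\{\sum_{j=1}^m\sup_{s<u<t}\frac{\|h_{j,tus}\|_{B_\alpha}}{|t-u|^{\rho_j}|u-s|^{\gamma-\rho_j}}:h=\sum_{j=1}^mh_j,\ m\in\mathbb{N},\ 0<\rho_j<\gamma\}$; $C^\gamma(\Delta_T^3;B_\alpha)$ is the set of finite norm; $Z\hat C^\gamma(\Delta_T^3;B_\alpha):=\ker\hat\delta\cap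 C^\gamma(\Delta_T^3;B_\alpha)$. Dyadic recursion with the heat spectral splitting. Let $\mathcal D:=\bigcup_{n\ge0}\{kT2^{-n}:0\le k\le2^n\}$; a dyadic interval is an interval between consecutive points of some $\{kT2^{-n}:0\le k\le 2^n\}$. Let $B^H_{ts}:=-H_{ts0}$. A path $I:\mathcal D\to B_\alpha$ is built with $R_{ts}:=B^H_{ts}-I_t+S_{t-s}I_s$: set $I_0:=0$, $I_T:=B^H_{T0}$; once $I$ is defined at the endpoints of a dyadic interval $[a,c]$ with midpoint $b=(a+c)/2$, $h:=c-b=L/2$, $L=c-a$, put $Q_{ca}:=R_{ca}$, $Y_{cba}:=Q_{ca}-H_{cba}$, and define the child residuals by $$Q_{ba}:=\tfrac12S_h^{-1}P_{\le N_h}Y_{cba},\qquad Q_{cb}:=\tfrac12P_{\le N_h}Y_{cba}+P_{>N_h}Y_{cba},$$ and $I_b:=B^H_{ba}+S_{b-a}I_a-Q_{ba}$. (One has $Q_{ca}=Q_{cb}+S_hQ_{ba}+H_{cba}$.) Parabolic tail condition with parameters $(\beta,\sigma,K)$: for every dyadic parent interval $[a,c]$ with midpoint $b=(a+c)/2$, length $L=c-a$, $h=c-b=L/2$, residual $Q_{ca}$ generated by the dyadic recursion with the heat spectral splitting, and $Y_{cba}=Q_{ca}-H_{cba}$, one has $\|P_{>N_h}Y_{cba}\|_{H^\alpha}\le KL^{\gamma+\rho}$ with $\rho:=\sigma\beta/2>0$ (with $L^{1+\rho}$ when $\gamma=1$). Admissibility of a splitting with $Q_{ca}=Q_{cb}+S_{c-b}Q_{ba}+H_{cba}$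 at each step: subcritical admissible ($0<\gamma<1$) if there are $0\le\theta<2^{-\gamma}$ and $C_H\ge0$ with $\max\{\|Q_{cb}\|_{B_\alpha},\|Q_{ba}\|_{B_\alpha}\}\le\theta\|Q_{ca}\|_{B_\alpha}+C_HL^\gamma$ for every generated residual; critical admissible ($\gamma=1$) if there are $C_H,C_\ast,\eta>0$ with $\max\{\|Q_{cb}\|_{B_\alpha},\|Q_{ba}\|_{B_\alpha}\}\le(\tfrac12+C_\ast L^\eta)\|Q_{ca}\|_{B_\alpha}+C_HL$ for every generated residual. *)

theory Defs
  imports "HOL-Analysis.Analysis" "HOL-Library.Function_Algebras"
begin

section \<open>Fourier analysis on the torus\<close>

text \<open>
  The torus is \<open>(\<real>/2\<pi>\<int>)\<^sup>d\<close>, with \<open>d = CARD('d)\<close>, and its Haar measure is normalised to mass 1.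
  Since elements of \<open>H\<^sup>\<alpha>\<close> are only distributions when \<open>\<alpha> < 0\<close>, a distribution \<open>u\<close> is represented by
  its family of Fourier coefficients \<open>u k\<close>, \<open>k \<in> \<int>\<^sup>d\<close>, that is, by the formal series
  \<open>\<Sum>k. u k * character k x\<close>.  All operators used below are functions of \<open>1 - \<Delta>\<close> and hence Fourier
  multipliers.  The lemmas \<open>one_minus_laplacian_character\<close> and \<open>parseval_trig_poly\<close> tie this
  representation to functions of \<open>x\<close>.
\<close>

type_synonym 'd torus_dist = "(int, 'd) vec \<Rightarrow> complex"

definition freq :: "int ^ 'd \<Rightarrow> real ^ 'd" where
  "freq k = (\<chi> i. real_of_int (k $ i))"

definition character :: "int ^ 'd::finite \<Rightarrow> real ^ 'd \<Rightarrow> complex" where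
  "character k x = exp (\<i> * of_real (freq k \<bullet> x))"

definition laplacian :: "(real ^ 'd::finite \<Rightarrow> complex) \<Rightarrow> real ^ 'd \<Rightarrow> complex" where
  "laplacian f x = (\<Sum>i\<in>UNIV.
     vector_derivative (\<lambda>s. vector_derivative (\<lambda>r. f (x + r *\<^sub>R axis i 1)) (at s)) (at 0))"

definition A0_eigenvalue :: "int ^ 'd::finite \<Rightarrow> real" where
  "A0_eigenvalue k = 1 + (norm (freq k))\<^sup>2"

lemma one_minus_laplacian_character:
  fixes k :: "int ^ 'd::finite"
  shows "character k x - laplacian (character k) x = of_real (A0_eigenvalue k) * character k x"
proof -
  have d: "((\<lambda>r. w * character k (x + r *\<^sub>R axis i 1)) has_vector_derivative
          w * (\<i> * of_real (freq k $ i)) * character k (x + s *\<^sub>R axis i 1)) (at s)" for i s w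
  proof -
    let ?p = "of_real (freq k \<bullet> x) :: complex" and ?c = "of_real (freq k $ i) :: complex"
    have "((\<lambda>z. w * exp (\<i> * (?p + z * ?c))) has_field_derivative
        w * (\<i> * ?c) * exp (\<i> * (?p + of_real s * ?c))) (at (of_real s))"
      by (auto intro!: derivative_eq_intros simp: algebra_simps)
    from has_vector_derivative_real_field[OF this] show ?thesis
      by (simp add: character_def inner_add_right inner_axis)
  qed
  have v: "vector_derivative (\<lambda>r. w * character k (x + r *\<^sub>R axis i 1)) (at s)
        = w * (\<i> * of_real (freq k $ i)) * character k (x + s *\<^sub>R axis i 1)" for i s w
    by (rule vector_derivative_at[OF d])
  have v1: "vector_derivative (\<lambda>r. character k (x + r *\<^sub>R axis i 1)) (at s)
        = (\<i> * of_real (freq k $ i)) * character k (x + s *\<^sub>R axis i 1)" for i s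
    using v[of 1] by simp
  have "laplacian (character k) x = (\<Sum>i\<in>UNIV. - of_real ((freq k $ i)\<^sup>2) * character k x)"
    unfolding laplacian_def v1 v
    by (intro sum.cong) (auto simp: power2_eq_square algebra_simps)
  also have "\<dots> = - of_real ((norm (freq k))\<^sup>2) * character k x"
    unfolding norm_vec_def L2_set_def
    by (simp add: sum_nonneg sum_distrib_right sum_negf)
  finally show ?thesis
    by (simp add: A0_eigenvalue_def algebra_simps)
qed

lemma integral_exp_period:
  fixes m :: int
  shows "has_bochner_integral lborel
    (\<lambda>s. indicator {0..2 * pi} s *\<^sub>R exp (\<i> * of_real (of_int m * s)))
    (if m = 0 then of_real (2 * pi) else 0 :: complex)"
proof (cases "m = 0")
  case True
  have "has_bochner_integral lborel (\<lambda>s. indicator {0..2 * pi} s *\<^sub>R (1::complex))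
      (of_real (2 * pi) - of_real 0)"
    by (rule has_bochner_integral_FTC_Icc)
       (auto intro!: has_vector_derivative_of_real derivative_eq_intros
         simp: of_real_def has_vector_derivative_def)
  then show ?thesis
    using True by simp
next
  case False
  let ?F = "\<lambda>z. exp (\<i> * (of_int m * z)) / (\<i> * of_int m) :: complex"
  have "(?F has_field_derivative
      exp (\<i> * (of_int m * of_real s)) * (\<i> * of_int m) / (\<i> * of_int m)) (at (of_real s))" for s
    by (intro DERIV_cdivide) (auto intro!: derivative_eq_intros)
  then have "(?F has_field_derivative exp (\<i> * (of_int m * of_real s))) (at (of_real s))" for s
    using False by simp
  then have F: "((\<lambda>s. ?F (of_real s)) has_vector_derivative exp (\<i> * of_real (of_int m * s)))
      (at s within {0..2 * pi})" for s
    using has_vector_derivative_real_field has_vector_derivative_at_within by fastforce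
  have "exp (\<i> * (of_int m * of_real (2 * pi))) = (1::complex)"
    by (auto simp: exp_eq_1 intro: exI[of _ m])
  then have "?F (of_real (2 * pi)) - ?F (of_real 0) = 0"
    by simp
  moreover have "continuous_on {0..2 * pi} (\<lambda>s. exp (\<i> * of_real (of_int m * s)) :: complex)"
    by (intro continuous_intros)
  ultimately show ?thesis
    using has_bochner_integral_FTC_Icc[where F = "\<lambda>s. ?F (of_real s)", OF _ F] False
    by simp
qed

lemma integral_character:
  fixes k :: "int ^ 'd::finite"
  shows "has_bochner_integral lborel
    (\<lambda>x. indicator (cbox 0 (\<chi> i. 2 * pi)) x *\<^sub>R character k x)
    (if k = 0 then of_real ((2 * pi) ^ CARD('d)) else 0)"
proof -
  let ?m = "\<lambda>b :: real ^ 'd. \<lfloor>freq k \<bullet> b\<rfloor>"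
  let ?f = "\<lambda>b s. indicator {0..2 * pi} s *\<^sub>R exp (\<i> * of_real (of_int (?m b) * s)) :: complex"
  let ?g = "\<lambda>x :: real ^ 'd. \<Prod>b\<in>Basis. ?f b (x \<bullet> b)"
  have m: "of_int (?m b) = freq k \<bullet> b" if "b \<in> Basis" for b
    using that by (auto simp: Basis_vec_def inner_axis freq_def)
  have g: "indicator (cbox 0 (\<chi> i. 2 * pi)) x *\<^sub>R character k x = ?g x" for x
  proof -
    have "character k x = (\<Prod>b\<in>Basis. exp (\<i> * of_real (of_int (?m b) * (x \<bullet> b))))"
      unfolding character_def
      by (subst euclidean_inner[of "freq k"])
         (simp add: m exp_sum sum_distrib_left flip: exp_sum)
    moreover have "indicator (cbox 0 (\<chi> i. 2 * pi)) x
        = (\<Prod>b\<in>Basis. indicator {0..2 * pi} (x \<bullet> b) :: real)"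
    proof (cases "x \<in> cbox 0 (\<chi> i. 2 * pi)")
      case True
      then have "x \<bullet> b \<in> {0..2 * pi}" if "b \<in> Basis" for b
        using that by (auto simp: mem_box Basis_vec_def inner_axis)
      then show ?thesis using True by simp
    next
      case False
      then have "\<exists>b\<in>Basis. x \<bullet> b \<notin> {0..2 * pi}"
        by (auto simp: mem_box Basis_vec_def inner_axis)
      then have "\<exists>b\<in>Basis. indicator {0..2 * pi} (x \<bullet> b) = (0 :: real)"
        by (meson indicator_simps(2))
      then show ?thesis using False by (simp add: prod_zero_iff)
    qed
    ultimately show ?thesis
      by (simp add: scaleR_conv_of_real prod.distrib)
  qed
  interpret product_sigma_finite "\<lambda>_ :: real ^ 'd. lborel :: real measure"
    by standard
  have [measurable]: "?g \<in> borel_measurable borel"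
    by measurable
  have i: "integrable lborel (?f b)" for b
    using integral_exp_period by (auto simp: has_bochner_integral_iff)
  have I: "integral\<^sup>L lborel (?f b) = (if ?m b = 0 then of_real (2 * pi) else 0)" for b
    using integral_exp_period by (auto simp: has_bochner_integral_iff)
  have "integrable lborel ?g"
    by (subst lborel_eq, subst integrable_distr_eq)
       (use i in \<open>auto intro!: product_integrable_prod\<close>)
  moreover have "integral\<^sup>L lborel ?g = (\<Prod>b\<in>Basis. integral\<^sup>L lborel (?f b))"
    by (subst lborel_eq, subst integral_distr)
       (use product_integral_prod[of Basis ?f, OF finite_Basis i] in auto)
  moreover have "(\<Prod>b\<in>Basis. integral\<^sup>L lborel (?f b))
      = (if k = 0 then of_real ((2 * pi) ^ CARD('d)) else 0)"
  proof (cases "k = 0")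
    case True
    then have "?m b = 0" for b by (simp add: freq_def inner_vec_def)
    then show ?thesis using True by (simp add: I scaleR_conv_of_real)
  next
    case False
    then obtain i where "k $ i \<noteq> 0" by (auto simp: vec_eq_iff)
    then have "?m (axis i 1) \<noteq> 0" by (simp add: freq_def inner_axis)
    moreover have "axis i (1::real) \<in> Basis" by (auto simp: Basis_vec_def)
    ultimately have "(\<Prod>b\<in>Basis. integral\<^sup>L lborel (?f b)) = 0"
      unfolding I by (intro prod_zero) auto
    then show ?thesis using False by simp
  qed
  ultimately show ?thesis
    unfolding g has_bochner_integral_iff by simp
qed

lemma parseval_trig_poly:
  fixes c :: "'d::finite torus_dist"
  assumes "finite F"
  shows "(\<integral>x\<in>cbox 0 (\<chi> i. 2 * pi). (cmod (\<Sum>k\<in>F. c k * character k x))\<^sup>2 \<partial>lborel)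
      / (2 * pi) ^ CARD('d) = (\<Sum>k\<in>F. (cmod (c k))\<^sup>2)"
proof -
  let ?Q = "cbox 0 (\<chi> i. 2 * pi) :: (real ^ 'd) set"
  let ?V = "of_real ((2 * pi) ^ CARD('d)) :: complex"
  let ?p = "\<lambda>x. \<Sum>k\<in>F. c k * character k x"
  have sq: "of_real ((cmod (?p x))\<^sup>2) =
      (\<Sum>k\<in>F. \<Sum>l\<in>F. c k * cnj (c l) * character (k - l) x)" for x
  proof -
    have "character (k - l) x = character k x * cnj (character l x)" for k l :: "int ^ 'd"
    proof -
      have "freq (k - l) = freq k - freq l" by (simp add: freq_def vec_eq_iff)
      then show ?thesis
        by (simp add: character_def inner_diff_left exp_cnj ring_distribs flip: exp_add)
    qed
    then show ?thesis
      unfolding complex_norm_square by (simp add: sum_product ac_simps)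
  qed
  have "has_bochner_integral lborel
      (\<lambda>x. \<Sum>k\<in>F. \<Sum>l\<in>F. c k * cnj (c l) * (indicator ?Q x *\<^sub>R character (k - l) x))
      (\<Sum>k\<in>F. \<Sum>l\<in>F. c k * cnj (c l) * (if k - l = 0 then ?V else 0))"
    by (intro has_bochner_integral_sum has_bochner_integral_mult_right integral_character)
  also have "(\<lambda>x. \<Sum>k\<in>F. \<Sum>l\<in>F. c k * cnj (c l) * (indicator ?Q x *\<^sub>R character (k - l) x))
      = (\<lambda>x. of_real (indicator ?Q x *\<^sub>R (cmod (?p x))\<^sup>2))"
    by (rule ext) (simp add: sq scaleR_conv_of_real sum_distrib_left mult_ac del: of_real_power)
  also have "(\<Sum>k\<in>F. \<Sum>l\<in>F. c k * cnj (c l) * (if k - l = 0 then ?V else 0))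
      = of_real ((\<Sum>k\<in>F. (cmod (c k))\<^sup>2) * (2 * pi) ^ CARD('d))"
    using assms
    by (simp add: if_distrib[of "\<lambda>z. _ * z"] sum_distrib_right complex_norm_square
        cong: if_cong del: of_real_power)
  finally have "(\<integral>x. complex_of_real (indicator ?Q x *\<^sub>R (cmod (?p x))\<^sup>2) \<partial>lborel) =
      of_real ((\<Sum>k\<in>F. (cmod (c k))\<^sup>2) * (2 * pi) ^ CARD('d))"
    by (rule has_bochner_integral_integral_eq)
  then have "(\<integral>x. indicator ?Q x *\<^sub>R (cmod (?p x))\<^sup>2 \<partial>lborel) =
      (\<Sum>k\<in>F. (cmod (c k))\<^sup>2) * (2 * pi) ^ CARD('d)"
    unfolding integral_complex_of_real of_real_eq_iff .
  then show ?thesis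
    by (simp add: set_lebesgue_integral_def)
qed

section \<open>Spectral calculus of \<open>A\<^sub>0 = 1 - \<Delta>\<close> and Sobolev spaces\<close>

definition spectral :: "(real \<Rightarrow> complex) \<Rightarrow> 'd::finite torus_dist \<Rightarrow> 'd torus_dist" where
  "spectral m u = (\<lambda>k. m (A0_eigenvalue k) * u k)"

definition A0_power :: "real \<Rightarrow> 'd::finite torus_dist \<Rightarrow> 'd torus_dist" where
  "A0_power r = spectral (\<lambda>\<mu>. of_real (\<mu> powr r))"

definition heat :: "real \<Rightarrow> 'd::finite torus_dist \<Rightarrow> 'd torus_dist" where
  "heat t = spectral (\<lambda>\<mu>. of_real (exp (- t * \<mu>)))"

definition L2_space :: "'d::finite torus_dist set" where
  "L2_space = {u. (\<lambda>k. (cmod (u k))\<^sup>2) summable_on UNIV}"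

definition L2_norm :: "'d::finite torus_dist \<Rightarrow> real" where
  "L2_norm u = sqrt (\<Sum>\<^sub>\<infinity>k. (cmod (u k))\<^sup>2)"

definition sobolev :: "real \<Rightarrow> 'd::finite torus_dist set" where
  "sobolev \<alpha> = {u. A0_power (\<alpha> / 2) u \<in> L2_space}"

definition sobolev_norm :: "real \<Rightarrow> 'd::finite torus_dist \<Rightarrow> real" where
  "sobolev_norm \<alpha> u = L2_norm (A0_power (\<alpha> / 2) u)"

text \<open>\<open>c0\<close> is the constant in the cut-off \<open>\<mu> \<le> c0 * N\<^sup>2\<close>.\<close>

definition P_le :: "real \<Rightarrow> real \<Rightarrow> 'd::finite torus_dist \<Rightarrow> 'd torus_dist" where
  "P_le c0 N = spectral (\<lambda>\<mu>. if \<mu> \<le> c0 * N\<^sup>2 then 1 else 0)"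

definition P_gt :: "real \<Rightarrow> real \<Rightarrow> 'd::finite torus_dist \<Rightarrow> 'd torus_dist" where
  "P_gt c0 N u = u - P_le c0 N u"

definition heat_inv_P_le :: "real \<Rightarrow> real \<Rightarrow> real \<Rightarrow> 'd::finite torus_dist \<Rightarrow> 'd torus_dist" where
  "heat_inv_P_le c0 h N u = spectral (\<lambda>\<mu>. of_real (exp (h * \<mu>))) (P_le c0 N u)"

definition cutoff :: "real \<Rightarrow> real \<Rightarrow> real" where
  "cutoff \<sigma> h = h powr (- \<sigma> / 2)"

definition half :: "'d::finite torus_dist \<Rightarrow> 'd torus_dist" where
  "half u = (\<lambda>k. u k / 2)"


section \<open>Two-increments\<close>

text \<open>A map \<open>H\<close> on the simplex is written \<open>H t u s\<close> with \<open>s \<le> u \<le> t\<close>; its values outside the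
  simplex are irrelevant.\<close>

type_synonym 'd incr = "real \<Rightarrow> real \<Rightarrow> real \<Rightarrow> 'd torus_dist"

definition simplex3 :: "real \<Rightarrow> (real \<times> real \<times> real) set" where
  "simplex3 T = {(t, u, s). 0 \<le> s \<and> s \<le> u \<and> u \<le> t \<and> t \<le> T}"

definition C3 :: "real \<Rightarrow> real \<Rightarrow> 'd::finite incr set" where
  "C3 \<alpha> T = {g. \<forall>(t, u, s) \<in> simplex3 T. g t u s \<in> sobolev \<alpha> \<and>
     ((\<lambda>(t', u', s'). sobolev_norm \<alpha> (g t' u' s' - g t u s)) \<longlongrightarrow> 0) (at (t, u, s) within simplex3 T)}"

text \<open>The twisted coboundary on two-increments, that is, \<open>n = 3\<close> in the general formula.\<close>

definition delta_hat :: "'d::finite incr \<Rightarrow> real \<Rightarrow> real \<Rightarrow> real \<Rightarrow> real \<Rightarrow> 'd torus_dist" where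
  "delta_hat g t1 t2 t3 t4 =
     - g t2 t3 t4 + g t1 t3 t4 - g t1 t2 t4 + g t1 t2 t3
     - (heat (t1 - t2) (g t2 t3 t4) - g t2 t3 t4)"

definition C3_decomps ::
  "real \<Rightarrow> real \<Rightarrow> real \<Rightarrow> 'd::finite incr \<Rightarrow> (nat \<times> (nat \<Rightarrow> 'd incr) \<times> (nat \<Rightarrow> real)) set" where
  "C3_decomps \<gamma> \<alpha> T h = {(m, g, r).
     (\<forall>j<m. g j \<in> C3 \<alpha> T \<and> 0 < r j \<and> r j < \<gamma>) \<and>
     (\<forall>(t, u, s) \<in> simplex3 T. h t u s = (\<Sum>j<m. g j t u s))}"

definition C3_norm :: "real \<Rightarrow> real \<Rightarrow> real \<Rightarrow> 'd::finite incr \<Rightarrow> ennreal" where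
  "C3_norm \<gamma> \<alpha> T h = (INF (m, g, r) \<in> C3_decomps \<gamma> \<alpha> T h.
     \<Sum>j<m. SUP (t, u, s) \<in> {(t, u, s). 0 \<le> s \<and> s < u \<and> u < t \<and> t \<le> T}.
       ennreal (sobolev_norm \<alpha> (g j t u s) / (\<bar>t - u\<bar> powr r j * \<bar>u - s\<bar> powr (\<gamma> - r j))))"

definition ZC3 :: "real \<Rightarrow> real \<Rightarrow> real \<Rightarrow> 'd::finite incr set" where
  "ZC3 \<gamma> \<alpha> T = {h \<in> C3 \<alpha> T. C3_norm \<gamma> \<alpha> T h < \<infinity> \<and>
     (\<forall>t1 t2 t3 t4. 0 \<le> t4 \<and> t4 \<le> t3 \<and> t3 \<le> t2 \<and> t2 \<le> t1 \<and> t1 \<le> T \<longrightarrow>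
        delta_hat h t1 t2 t3 t4 = 0)}"


section \<open>Dyadic recursion\<close>

text \<open>The parent interval \<open>[a, c]\<close> with index \<open>(n, k)\<close>, \<open>k < 2 ^ n\<close>, has
  \<open>a = dyadic T n k\<close> and \<open>c = dyadic T n (k + 1)\<close>.  Its children \<open>[a, b]\<close> and \<open>[b, c]\<close> have
  indices \<open>(n + 1, 2 * k)\<close> and \<open>(n + 1, 2 * k + 1)\<close>.\<close>

definition dyadic :: "real \<Rightarrow> nat \<Rightarrow> nat \<Rightarrow> real" where
  "dyadic T n k = real k * T / 2 ^ n"

definition midpt :: "real \<Rightarrow> nat \<Rightarrow> nat \<Rightarrow> real" where
  "midpt T n k = (dyadic T n k + dyadic T n (k + 1)) / 2"

definition dlen :: "real \<Rightarrow> nat \<Rightarrow> nat \<Rightarrow> real" where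
  "dlen T n k = dyadic T n (k + 1) - dyadic T n k"

definition dhalf :: "real \<Rightarrow> nat \<Rightarrow> nat \<Rightarrow> real" where
  "dhalf T n k = dyadic T n (k + 1) - midpt T n k"

definition H_at :: "'d::finite incr \<Rightarrow> real \<Rightarrow> nat \<Rightarrow> nat \<Rightarrow> 'd torus_dist" where
  "H_at H T n k = H (dyadic T n (k + 1)) (midpt T n k) (dyadic T n k)"

definition BH :: "'d::finite incr \<Rightarrow> real \<Rightarrow> real \<Rightarrow> 'd torus_dist" where
  "BH H t s = - H t s 0"

text \<open>The residual \<open>R\<^sub>t\<^sub>s\<close> for given values of the path at \<open>t\<close> and \<open>s\<close>.\<close>

definition remainder ::
  "'d::finite incr \<Rightarrow> real \<Rightarrow> real \<Rightarrow> 'd torus_dist \<Rightarrow> 'd torus_dist \<Rightarrow> 'd torus_dist" where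
  "remainder H t s It Is = BH H t s - It + heat (t - s) Is"

definition split_left :: "real \<Rightarrow> real \<Rightarrow> real \<Rightarrow> 'd::finite torus_dist \<Rightarrow> 'd torus_dist" where
  "split_left c0 \<sigma> h Y = half (heat_inv_P_le c0 h (cutoff \<sigma> h) Y)"

definition split_right :: "real \<Rightarrow> real \<Rightarrow> real \<Rightarrow> 'd::finite torus_dist \<Rightarrow> 'd torus_dist" where
  "split_right c0 \<sigma> h Y = half (P_le c0 (cutoff \<sigma> h) Y) + P_gt c0 (cutoff \<sigma> h) Y"

text \<open>\<open>heat_path c0 \<sigma> T H n k\<close> is the value of the path \<open>I\<close> at the time \<open>dyadic T n k\<close>, \<open>k \<le> 2 ^ n\<close>.\<close>

primrec heat_path ::
  "real \<Rightarrow> real \<Rightarrow> real \<Rightarrow> 'd::finite incr \<Rightarrow> nat \<Rightarrow> nat \<Rightarrow> 'd torus_dist" where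
  "heat_path c0 \<sigma> T H 0 k = (if k = 0 then 0 else BH H T 0)"
| "heat_path c0 \<sigma> T H (Suc n) k =
     (if even k then heat_path c0 \<sigma> T H n (k div 2)
      else let
        j = k div 2;
        a = dyadic T n j; c = dyadic T n (j + 1); b = midpt T n j;
        Ia = heat_path c0 \<sigma> T H n j; Ic = heat_path c0 \<sigma> T H n (j + 1);
        Y = remainder H c a Ic Ia - H_at H T n j
      in BH H b a + heat (b - a) Ia - split_left c0 \<sigma> (dhalf T n j) Y)"

definition heat_residual ::
  "real \<Rightarrow> real \<Rightarrow> real \<Rightarrow> 'd::finite incr \<Rightarrow> nat \<Rightarrow> nat \<Rightarrow> 'd torus_dist" where
  "heat_residual c0 \<sigma> T H n k = remainder H (dyadic T n (k + 1)) (dyadic T n k)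
     (heat_path c0 \<sigma> T H n (k + 1)) (heat_path c0 \<sigma> T H n k)"

definition heat_Y ::
  "real \<Rightarrow> real \<Rightarrow> real \<Rightarrow> 'd::finite incr \<Rightarrow> nat \<Rightarrow> nat \<Rightarrow> 'd torus_dist" where
  "heat_Y c0 \<sigma> T H n k = heat_residual c0 \<sigma> T H n k - H_at H T n k"

definition heat_left ::
  "real \<Rightarrow> real \<Rightarrow> real \<Rightarrow> 'd::finite incr \<Rightarrow> nat \<Rightarrow> nat \<Rightarrow> 'd torus_dist" where
  "heat_left c0 \<sigma> T H n k = split_left c0 \<sigma> (dhalf T n k) (heat_Y c0 \<sigma> T H n k)"

definition heat_right ::
  "real \<Rightarrow> real \<Rightarrow> real \<Rightarrow> 'd::finite incr \<Rightarrow> nat \<Rightarrow> nat \<Rightarrow> 'd torus_dist" where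
  "heat_right c0 \<sigma> T H n k = split_right c0 \<sigma> (dhalf T n k) (heat_Y c0 \<sigma> T H n k)"

definition parabolic_tail ::
  "real \<Rightarrow> real \<Rightarrow> real \<Rightarrow> real \<Rightarrow> real \<Rightarrow> real \<Rightarrow> real \<Rightarrow> 'd::finite incr \<Rightarrow> bool" where
  "parabolic_tail \<gamma> \<alpha> c0 \<beta> \<sigma> K T H \<longleftrightarrow> (\<forall>n. \<forall>k<2 ^ n.
     sobolev_norm \<alpha> (P_gt c0 (cutoff \<sigma> (dhalf T n k)) (heat_Y c0 \<sigma> T H n k))
       \<le> K * dlen T n k powr (\<gamma> + \<sigma> * \<beta> / 2))"


section \<open>Admissible splittings\<close>

text \<open>A splitting is given by the residuals \<open>Q n k\<close> it generates on the dyadic intervals with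
  index \<open>(n, k)\<close>.  Membership in the Sobolev space is part of the notion because \<open>sobolev_norm\<close> is
  meaningful only there.\<close>

definition scale_splitting ::
  "real \<Rightarrow> real \<Rightarrow> 'd::finite incr \<Rightarrow> (nat \<Rightarrow> nat \<Rightarrow> 'd torus_dist) \<Rightarrow> bool" where
  "scale_splitting \<alpha> T H Q \<longleftrightarrow> (\<forall>n. \<forall>k<2 ^ n. Q n k \<in> sobolev \<alpha> \<and>
     Q n k = Q (n + 1) (2 * k + 1) + heat (dhalf T n k) (Q (n + 1) (2 * k)) + H_at H T n k)"

definition subcritical_admissible ::
  "real \<Rightarrow> real \<Rightarrow> real \<Rightarrow> 'd::finite incr \<Rightarrow> (nat \<Rightarrow> nat \<Rightarrow> 'd torus_dist) \<Rightarrow> bool" where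
  "subcritical_admissible \<gamma> \<alpha> T H Q \<longleftrightarrow> 0 < \<gamma> \<and> \<gamma> < 1 \<and> scale_splitting \<alpha> T H Q \<and>
     (\<exists>\<theta> CH. 0 \<le> \<theta> \<and> \<theta> < 2 powr (- \<gamma>) \<and> 0 \<le> CH \<and> (\<forall>n. \<forall>k<2 ^ n.
        max (sobolev_norm \<alpha> (Q (n + 1) (2 * k + 1))) (sobolev_norm \<alpha> (Q (n + 1) (2 * k)))
          \<le> \<theta> * sobolev_norm \<alpha> (Q n k) + CH * dlen T n k powr \<gamma>))"

text \<open>The critical case is \<open>\<gamma> = 1\<close>.\<close>

definition critical_admissible ::
  "real \<Rightarrow> real \<Rightarrow> 'd::finite incr \<Rightarrow> (nat \<Rightarrow> nat \<Rightarrow> 'd torus_dist) \<Rightarrow> bool" where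
  "critical_admissible \<alpha> T H Q \<longleftrightarrow> scale_splitting \<alpha> T H Q \<and>
     (\<exists>CH Cstar \<eta>. 0 < CH \<and> 0 < Cstar \<and> 0 < \<eta> \<and> (\<forall>n. \<forall>k<2 ^ n.
        max (sobolev_norm \<alpha> (Q (n + 1) (2 * k + 1))) (sobolev_norm \<alpha> (Q (n + 1) (2 * k)))
          \<le> (1 / 2 + Cstar * dlen T n k powr \<eta>) * sobolev_norm \<alpha> (Q n k) + CH * dlen T n k))"

end

theory Submission
  imports Defs
begin

text \<open>
  All operators involved are Fourier multipliers, so the whole argument takes place frequency by
  frequency.

  \<^emph>\<open>The factor \<open>1/2\<close>.\<close>  Below the cut-off \<open>\<mu> \<le> c0 N\<^sub>h\<^sup>2 = c0 h powr (- \<sigma>)\<close> the backward heat flow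
  is harmless: \<open>h \<mu> \<le> c0 h powr (1 - \<sigma>)\<close> is small, so the symbol \<open>exp (h \<mu>) / 2\<close> of the left child
  exceeds \<open>1/2\<close> by \<open>O(h powr (1 - \<sigma>))\<close> only (lemma \<open>split_left_bounded\<close>).  The right child has symbol
  \<open>1/2\<close> below the cut-off; above it the child equals \<open>Y\<close>, which the tail condition controls by
  \<open>K L powr \<gamma>\<close>.  Passing from \<open>Y\<close> to the residual \<open>Q\<close> costs the norm of the increment \<open>H\<close> at
  the midpoint, and this is at most \<open>\<parallel>H\<parallel> L powr \<gamma>\<close> because at equally spaced times the weights of all
  terms of a decomposition of \<open>H\<close> coincide (lemma \<open>ZC3_equidistant_bound\<close>).  Together these give
  \<open>heat_children_bound\<close>, with the constant \<open>1 + c0 exp c0\<close> whatever the horizon in \<open>(0, 1]\<close>.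

  \<^emph>\<open>The children are the residuals of the path.\<close>  For the left child this is how the path is
  defined at the midpoint; for the right child it is the vanishing of the twisted coboundary of \<open>H\<close> on
  \<open>0 \<le> a \<le> b \<le> c\<close> (lemma \<open>heat_residual_right\<close>).  Hence the bound is an admissibility estimate, with
  \<open>\<theta> = 1/2 + C T0 powr \<eta>\<close> in the subcritical case.

  \<^emph>\<open>Restarting at a dyadic horizon.\<close>  The recursion on \<open>[0, T / 2 ^ m]\<close> starts from the residual
  zero, unlike the corresponding part of the recursion on \<open>[0, T]\<close>, so it is not a part of the latter.
  But the two initial residuals differ by a left child, which has no frequencies above the cut-off of
  its own length.  The splitting does not mix frequencies and the cut-off grows towards smaller
  scales, so the parts above the cut-off that the tail condition measures are the same in the two
  recursions, and the condition is inherited (lemma \<open>parabolic_tail_restart\<close>).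
\<close>

section \<open>Sobolev norms and Fourier multipliers\<close>

lemma L2_partial_le_sobolev_norm:
  assumes "u \<in> sobolev \<alpha>" "finite F"
  shows "L2_set (\<lambda>k. cmod (A0_power (\<alpha> / 2) u k)) F \<le> sobolev_norm \<alpha> u"
proof -
  have "(\<Sum>k\<in>F. (cmod (A0_power (\<alpha> / 2) u k))\<^sup>2) \<le> (\<Sum>\<^sub>\<infinity>k. (cmod (A0_power (\<alpha> / 2) u k))\<^sup>2)"
    using assms by (intro finite_sum_le_infsum) (auto simp: sobolev_def L2_space_def)
  then show ?thesis
    by (simp add: L2_set_def sobolev_norm_def L2_norm_def)
qed

text \<open>
  Bounding all finite partial sums gives membership and the norm bound at once.  Through this
  criterion the algebra of Sobolev norms reduces to finite sums, where Minkowski's inequality for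
  \<open>L2_set\<close> applies.
\<close>

lemma sobolev_of_L2_partial_bound:
  assumes bound: "\<And>F. finite F \<Longrightarrow> L2_set (\<lambda>k. cmod (A0_power (\<alpha> / 2) u k)) F \<le> B"
  shows "u \<in> sobolev \<alpha> \<and> sobolev_norm \<alpha> u \<le> B"
proof -
  let ?f = "\<lambda>k. (cmod (A0_power (\<alpha> / 2) u k))\<^sup>2"
  have B: "0 \<le> B"
    using bound[of "{}"] by simp
  have part: "sum ?f F \<le> B\<^sup>2" if "finite F" for F
    using bound[OF that] unfolding L2_set_def by (rule sqrt_le_D)
  then have s: "?f summable_on UNIV"
    by (intro nonneg_bdd_above_summable_on) (auto simp: bdd_above_def)
  then have "infsum ?f UNIV \<le> B\<^sup>2"
    using part by (intro infsum_le_finite_sums) auto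
  then have "sqrt (infsum ?f UNIV) \<le> B"
    using B by (simp add: real_le_lsqrt infsum_nonneg)
  then show ?thesis
    using s by (simp add: sobolev_def L2_space_def sobolev_norm_def L2_norm_def)
qed

lemma sobolev_norm_nonneg: "0 \<le> sobolev_norm \<alpha> u"
  by (simp add: sobolev_norm_def L2_norm_def infsum_nonneg)

lemma sobolev_zero_bounded:
  fixes z :: "'d::finite torus_dist"
  assumes "z = 0"
  shows "z \<in> sobolev \<alpha> \<and> sobolev_norm \<alpha> z \<le> 0"
proof (rule sobolev_of_L2_partial_bound)
  show "L2_set (\<lambda>k. cmod (A0_power (\<alpha> / 2) z k)) F \<le> 0" for F
    using assms by (simp add: L2_set_def A0_power_def spectral_def)
qed

lemmas sobolev_zero = sobolev_zero_bounded[OF refl, THEN conjunct1]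

lemma sobolev_norm_zero: "sobolev_norm \<alpha> 0 = 0"
  using sobolev_zero_bounded[OF refl] sobolev_norm_nonneg by (rule antisym[OF conjunct2])

lemma sobolev_add_bounded:
  assumes "u \<in> sobolev \<alpha>" "v \<in> sobolev \<alpha>"
  shows "u + v \<in> sobolev \<alpha> \<and> sobolev_norm \<alpha> (u + v) \<le> sobolev_norm \<alpha> u + sobolev_norm \<alpha> v"
proof (rule sobolev_of_L2_partial_bound)
  fix F :: "(int ^ 'a) set"
  assume F: "finite F"
  let ?A = "A0_power (\<alpha> / 2)"
  have "L2_set (\<lambda>k. cmod (?A (u + v) k)) F \<le> L2_set (\<lambda>k. cmod (?A u k) + cmod (?A v k)) F"
    by (intro L2_set_mono)
       (auto simp: A0_power_def spectral_def ring_distribs intro: norm_triangle_ineq)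
  also have "\<dots> \<le> L2_set (\<lambda>k. cmod (?A u k)) F + L2_set (\<lambda>k. cmod (?A v k)) F"
    by (rule L2_set_triangle_ineq)
  also have "\<dots> \<le> sobolev_norm \<alpha> u + sobolev_norm \<alpha> v"
    using assms F by (intro add_mono L2_partial_le_sobolev_norm)
  finally show "L2_set (\<lambda>k. cmod (?A (u + v) k)) F \<le> sobolev_norm \<alpha> u + sobolev_norm \<alpha> v" .
qed

lemmas sobolev_add = sobolev_add_bounded[THEN conjunct1]
lemmas sobolev_norm_triangle = sobolev_add_bounded[THEN conjunct2]

lemma spectral_bounded:
  fixes u :: "'d::finite torus_dist"
  assumes u: "u \<in> sobolev \<alpha>"
    and m: "\<And>k :: int ^ 'd. cmod (m (A0_eigenvalue k)) \<le> M"
  shows "spectral m u \<in> sobolev \<alpha> \<and> sobolev_norm \<alpha> (spectral m u) \<le> M * sobolev_norm \<alpha> u"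
proof (rule sobolev_of_L2_partial_bound)
  fix F :: "(int ^ 'd) set"
  assume F: "finite F"
  let ?A = "A0_power (\<alpha> / 2)"
  have M: "0 \<le> M"
    using m[of 0] norm_ge_zero order_trans by blast
  have "cmod (?A (spectral m u) k) = cmod (m (A0_eigenvalue k)) * cmod (?A u k)" for k
    by (simp add: A0_power_def spectral_def norm_mult)
  then have "L2_set (\<lambda>k. cmod (?A (spectral m u) k)) F \<le> L2_set (\<lambda>k. M * cmod (?A u k)) F"
    using m by (intro L2_set_mono) (auto intro: mult_right_mono)
  also have "\<dots> = M * L2_set (\<lambda>k. cmod (?A u k)) F"
    using M by (simp add: L2_set_right_distrib)
  also have "\<dots> \<le> M * sobolev_norm \<alpha> u"
    using u F M by (intro mult_left_mono L2_partial_le_sobolev_norm)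
  finally show "L2_set (\<lambda>k. cmod (?A (spectral m u) k)) F \<le> M * sobolev_norm \<alpha> u" .
qed

lemmas spectral_sobolev = spectral_bounded[THEN conjunct1]

lemma sobolev_uminus_bounded:
  assumes "u \<in> sobolev \<alpha>"
  shows "- u \<in> sobolev \<alpha> \<and> sobolev_norm \<alpha> (- u) \<le> sobolev_norm \<alpha> u"
proof -
  have "- u = spectral (\<lambda>_. - 1) u"
    by (simp add: spectral_def fun_Compl_def)
  then show ?thesis
    using spectral_bounded[OF assms, of "\<lambda>_. - 1" 1] by simp
qed

lemma sobolev_diff:
  assumes "u \<in> sobolev \<alpha>" "v \<in> sobolev \<alpha>"
  shows "u - v \<in> sobolev \<alpha>"
  using sobolev_add[OF assms(1) sobolev_uminus_bounded[THEN conjunct1, OF assms(2)]] by simp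

lemma sobolev_norm_diff_le:
  assumes "u \<in> sobolev \<alpha>" "v \<in> sobolev \<alpha>"
  shows "sobolev_norm \<alpha> (u - v) \<le> sobolev_norm \<alpha> u + sobolev_norm \<alpha> v"
  using sobolev_norm_triangle[OF assms(1) sobolev_uminus_bounded[THEN conjunct1, OF assms(2)]]
    sobolev_uminus_bounded[THEN conjunct2, OF assms(2)] by simp

lemma sobolev_sum_bounded:
  fixes m :: nat
  assumes "\<And>j. j < m \<Longrightarrow> g j \<in> sobolev \<alpha>"
  shows "(\<Sum>j<m. g j) \<in> sobolev \<alpha> \<and>
    sobolev_norm \<alpha> (\<Sum>j<m. g j) \<le> (\<Sum>j<m. sobolev_norm \<alpha> (g j))"
  using assms
proof (induction m)
  case 0
  then show ?case
    using sobolev_zero sobolev_norm_zero by (metis lessThan_0 order_refl sum.empty)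
next
  case (Suc m)
  then have "(\<Sum>j<m. g j) \<in> sobolev \<alpha> \<and>
      sobolev_norm \<alpha> (\<Sum>j<m. g j) \<le> (\<Sum>j<m. sobolev_norm \<alpha> (g j))" "g m \<in> sobolev \<alpha>"
    by auto
  then show ?case
    using sobolev_add[of "\<Sum>j<m. g j" \<alpha> "g m"] sobolev_norm_triangle[of "\<Sum>j<m. g j" \<alpha> "g m"]
    unfolding sum.lessThan_Suc by linarith
qed

lemma heat_add: "heat (s + t) u = heat s (heat t u)"
  by (simp add: heat_def spectral_def fun_eq_iff exp_add[symmetric] ring_distribs
      flip: mult.assoc of_real_mult)

section \<open>The spectral splitting of a single residual\<close>

text \<open>
  The left child, the projection and the low part of the right child as single multipliers; the rest
  of the argument evaluates their symbols.
\<close>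

lemma split_left_spectral:
  "split_left c0 \<sigma> h = spectral (\<lambda>\<mu>. if \<mu> \<le> c0 * (cutoff \<sigma> h)\<^sup>2 then of_real (exp (h * \<mu>) / 2) else 0)"
  by (auto simp: split_left_def half_def heat_inv_P_le_def P_le_def spectral_def fun_eq_iff)

lemma P_gt_spectral: "P_gt c0 N = spectral (\<lambda>\<mu>. if \<mu> \<le> c0 * N\<^sup>2 then 0 else 1)"
  by (auto simp: P_gt_def P_le_def spectral_def fun_eq_iff)

lemma half_P_le_spectral: "half (P_le c0 N u) = spectral (\<lambda>\<mu>. if \<mu> \<le> c0 * N\<^sup>2 then 1 / 2 else 0) u"
  by (auto simp: half_def P_le_def spectral_def fun_eq_iff)

text \<open>
  The heat flow undoes the factor \<open>exp (h \<mu>)\<close>, so the two low-frequency halves add up again.  This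
  identity is what makes the splitting consistent with the recursion.
\<close>

lemma split_reconstruct: "split_right c0 \<sigma> h Y + heat h (split_left c0 \<sigma> h Y) = Y"
proof
  fix k
  have "complex_of_real (exp (- (h * \<mu>))) * of_real (exp (h * \<mu>)) = 1" for \<mu>
    by (simp flip: of_real_mult exp_add)
  then show "(split_right c0 \<sigma> h Y + heat h (split_left c0 \<sigma> h Y)) k = Y k"
    unfolding split_right_def split_left_spectral P_gt_spectral half_P_le_spectral heat_def
    by (simp add: spectral_def flip: mult.assoc)
qed

text \<open>
  The choice of cut-off: on the frequencies that it retains, the exponent \<open>h \<mu>\<close> of the backward
  heat flow is at most \<open>c0 h powr (1 - \<sigma>)\<close>.
\<close>

lemma cutoff_square:
  assumes "0 < h"
  shows "h * (cutoff \<sigma> h)\<^sup>2 = h powr (1 - \<sigma>)"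
proof -
  have "(cutoff \<sigma> h)\<^sup>2 = h powr (- \<sigma>)"
    by (simp add: cutoff_def power2_eq_square flip: powr_add)
  then show ?thesis
    using assms by (simp add: powr_diff powr_minus divide_inverse)
qed

text \<open>
  With \<open>x = c0 h powr (1 - \<sigma>)\<close> the symbol is at most \<open>exp x / 2\<close>, and convexity gives
  \<open>exp x \<le> 1 + x exp x\<close>, where \<open>x \<le> c0\<close> makes the last exponential a constant.
\<close>

lemma split_left_bounded:
  assumes Y: "Y \<in> sobolev \<alpha>" and h: "0 < h" "h \<le> 1" and "\<sigma> < 1" "0 < c0"
  shows "split_left c0 \<sigma> h Y \<in> sobolev \<alpha> \<and>
    sobolev_norm \<alpha> (split_left c0 \<sigma> h Y)
      \<le> (1 / 2 + c0 * exp c0 / 2 * h powr (1 - \<sigma>)) * sobolev_norm \<alpha> Y"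
proof -
  define x where "x = c0 * h powr (1 - \<sigma>)"
  have "h powr (1 - \<sigma>) \<le> 1"
    using assms by (intro powr_le1) auto
  then have x: "0 \<le> x" "x \<le> c0"
    using \<open>0 < c0\<close> by (auto simp: x_def intro: mult_left_le)
  have "exp x \<le> 1 + x * exp x"
  proof -
    \<comment> \<open>multiply \<open>1 - x \<le> exp (- x)\<close> by \<open>exp x\<close>\<close>
    have "(1 - x) * exp x \<le> exp (- x) * exp x"
      using exp_ge_add_one_self[of "- x"] by (intro mult_right_mono) auto
    then show ?thesis
      by (simp add: algebra_simps flip: exp_add)
  qed
  also have "\<dots> \<le> 1 + x * exp c0"
    using x by (simp add: mult_left_mono)
  finally have ex: "exp x \<le> 1 + c0 * exp c0 * h powr (1 - \<sigma>)"
    by (simp add: x_def mult_ac)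
  have le: "exp (h * \<mu>) / 2 \<le> 1 / 2 + c0 * exp c0 / 2 * h powr (1 - \<sigma>)"
    if "\<mu> \<le> c0 * (cutoff \<sigma> h)\<^sup>2" for \<mu>
  proof -
    have "h * \<mu> \<le> c0 * (h * (cutoff \<sigma> h)\<^sup>2)"
      using that h(1) mult_left_mono[of \<mu> "c0 * (cutoff \<sigma> h)\<^sup>2" h] by (simp add: mult_ac)
    then have "h * \<mu> \<le> x"
      by (simp add: cutoff_square[OF h(1)] x_def)
    then have "exp (h * \<mu>) \<le> exp x" by simp
    then have "exp (h * \<mu>) \<le> 1 + c0 * exp c0 * h powr (1 - \<sigma>)"
      using ex by (rule order_trans)
    then show ?thesis
      by (simp add: field_simps)
  qed
  show ?thesis
    unfolding split_left_spectral
  proof (rule spectral_bounded[OF Y], goal_cases)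
    case (1 k)
    have "0 \<le> 1 / 2 + c0 * exp c0 / 2 * h powr (1 - \<sigma>)"
      using \<open>0 < c0\<close> by (intro add_nonneg_nonneg mult_nonneg_nonneg) auto
    then show ?case
      using le[of "A0_eigenvalue k"] by (simp add: norm_divide)
  qed
qed

lemma split_right_bounded:
  assumes Y: "Y \<in> sobolev \<alpha>"
  shows "split_right c0 \<sigma> h Y \<in> sobolev \<alpha> \<and>
    sobolev_norm \<alpha> (split_right c0 \<sigma> h Y)
      \<le> 1 / 2 * sobolev_norm \<alpha> Y + sobolev_norm \<alpha> (P_gt c0 (cutoff \<sigma> h) Y)"
proof -
  let ?N = "cutoff \<sigma> h"
  have 1: "half (P_le c0 ?N Y) \<in> sobolev \<alpha> \<and>
      sobolev_norm \<alpha> (half (P_le c0 ?N Y)) \<le> 1 / 2 * sobolev_norm \<alpha> Y"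
    unfolding half_P_le_spectral by (rule spectral_bounded[OF Y]) auto
  have 2: "P_gt c0 ?N Y \<in> sobolev \<alpha>"
    unfolding P_gt_spectral by (rule spectral_sobolev[OF Y, where M = 1]) auto
  show ?thesis
    unfolding split_right_def
    using sobolev_add_bounded[of "half (P_le c0 ?N Y)" \<alpha> "P_gt c0 ?N Y"] 1 2 by auto
qed

section \<open>Midpoint increments\<close>

lemma dyadic_Suc_even: "dyadic T (Suc n) (2 * k) = dyadic T n k"
  by (simp add: dyadic_def)

lemma dyadic_Suc_odd: "dyadic T (Suc n) (Suc (2 * k)) = midpt T n k"
  by (simp add: dyadic_def midpt_def field_simps)

lemma dyadic_Suc_odd_right: "dyadic T (Suc n) (Suc (Suc (2 * k))) = dyadic T n (Suc k)"
  using dyadic_Suc_even[of T n "Suc k"] by simp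

lemma dlen_eq: "dlen T n k = T / 2 ^ n"
  by (simp add: dlen_def dyadic_def field_simps)

lemma dhalf_eq: "dhalf T n k = T / 2 ^ Suc n"
  by (simp add: dhalf_def midpt_def dyadic_def field_simps)

lemma midpt_minus: "midpt T n k - dyadic T n k = dhalf T n k"
  by (simp add: dhalf_def midpt_def field_simps)

lemma dyadic_order:
  assumes "0 < T" "k < 2 ^ n"
  shows "0 \<le> dyadic T n k" "dyadic T n k < midpt T n k" "midpt T n k < dyadic T n (k + 1)"
    "dyadic T n (k + 1) \<le> T"
proof -
  have h: "0 < dhalf T n k"
    using assms by (simp add: dhalf_eq)
  show "0 \<le> dyadic T n k"
    using assms by (simp add: dyadic_def)
  show "dyadic T n k < midpt T n k"
    using h midpt_minus[of T n k] by simp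
  show "midpt T n k < dyadic T n (k + 1)"
    using h by (simp add: dhalf_def)
  have "real (k + 1) \<le> 2 ^ n"
    using assms(2) by (metis Suc_eq_plus1 Suc_leI of_nat_le_iff of_nat_numeral of_nat_power)
  then show "dyadic T n (k + 1) \<le> T"
    using assms(1) by (simp add: dyadic_def field_simps del: of_nat_add of_nat_Suc)
qed

text \<open>
  When \<open>t - u = u - s\<close>, the weight \<open>(t - u) powr r * (u - s) powr (\<gamma> - r)\<close> does not depend on \<open>r\<close>.
  The triangle inequality therefore bounds \<open>H\<close> by each competitor in the infimum that defines the norm.
\<close>

lemma ZC3_equidistant_bound:
  fixes H :: "'d::finite incr"
  assumes H: "H \<in> ZC3 \<gamma> \<alpha> T" and "0 \<le> s" "s < u" "u < t" "t \<le> T" and eq: "t - u = u - s"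
  shows "sobolev_norm \<alpha> (H t u s) \<le> enn2real (C3_norm \<gamma> \<alpha> T H) * (u - s) powr \<gamma>"
proof -
  have p: "(t, u, s) \<in> {(t, u, s). 0 \<le> s \<and> s < u \<and> u < t \<and> t \<le> T}" "(t, u, s) \<in> simplex3 T"
    using assms by (auto simp: simplex3_def)
  have "ennreal (sobolev_norm \<alpha> (H t u s) / (u - s) powr \<gamma>) \<le> C3_norm \<gamma> \<alpha> T H"
    unfolding C3_norm_def
  proof (rule INF_greatest, clarify)
    fix m and g :: "nat \<Rightarrow> 'd incr" and r :: "nat \<Rightarrow> real"
    assume d: "(m, g, r) \<in> C3_decomps \<gamma> \<alpha> T H"
    then have g: "g j t u s \<in> sobolev \<alpha>" if "j < m" for j
      using that p(2) by (fastforce simp: C3_decomps_def C3_def)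
    have Hsum: "H t u s = (\<Sum>j<m. g j t u s)"
      using d p(2) by (auto simp: C3_decomps_def)
    have weight: "\<bar>t - u\<bar> powr r j * \<bar>u - s\<bar> powr (\<gamma> - r j) = (u - s) powr \<gamma>" for j
      using eq \<open>s < u\<close> by (simp flip: powr_add)
    have "ennreal (sobolev_norm \<alpha> (H t u s) / (u - s) powr \<gamma>)
        \<le> ennreal (\<Sum>j<m. sobolev_norm \<alpha> (g j t u s) / (u - s) powr \<gamma>)"
      unfolding Hsum sum_divide_distrib[symmetric]
      using sobolev_sum_bounded[of m "\<lambda>j. g j t u s" \<alpha>] g
      by (intro ennreal_leI divide_right_mono) auto
    also have "\<dots> = (\<Sum>j<m. ennreal (sobolev_norm \<alpha> (g j t u s) / (u - s) powr \<gamma>))"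
      by (simp add: sum_ennreal sobolev_norm_nonneg)
    also have "\<dots> \<le> (\<Sum>j<m. SUP (t, u, s) \<in> {(t, u, s). 0 \<le> s \<and> s < u \<and> u < t \<and> t \<le> T}.
       ennreal (sobolev_norm \<alpha> (g j t u s) / (\<bar>t - u\<bar> powr r j * \<bar>u - s\<bar> powr (\<gamma> - r j))))"
      by (intro sum_mono SUP_upper2[OF p(1)]) (simp only: prod.case weight order_refl)
    finally show "ennreal (sobolev_norm \<alpha> (H t u s) / (u - s) powr \<gamma>) \<le>
      (\<Sum>j<m. SUP (t, u, s) \<in> {(t, u, s). 0 \<le> s \<and> s < u \<and> u < t \<and> t \<le> T}.
       ennreal (sobolev_norm \<alpha> (g j t u s) / (\<bar>t - u\<bar> powr r j * \<bar>u - s\<bar> powr (\<gamma> - r j))))" .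
  qed
  moreover have "C3_norm \<gamma> \<alpha> T H < top"
    using H by (simp add: ZC3_def)
  ultimately have "sobolev_norm \<alpha> (H t u s) / (u - s) powr \<gamma> \<le> enn2real (C3_norm \<gamma> \<alpha> T H)"
    using enn2real_mono[of "ennreal (sobolev_norm \<alpha> (H t u s) / (u - s) powr \<gamma>)"]
    by (simp add: sobolev_norm_nonneg)
  then show ?thesis
    using \<open>s < u\<close> by (simp add: divide_le_eq)
qed

lemma H_at_bounded:
  assumes H: "H \<in> ZC3 \<gamma> \<alpha> T" and T0: "0 < T0" "T0 \<le> T" and k: "k < 2 ^ n" and "0 < \<gamma>"
  shows "H_at H T0 n k \<in> sobolev \<alpha> \<and>
    sobolev_norm \<alpha> (H_at H T0 n k) \<le> enn2real (C3_norm \<gamma> \<alpha> T H) * dlen T0 n k powr \<gamma>"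
proof
  note o = dyadic_order[OF T0(1) k]
  show "H_at H T0 n k \<in> sobolev \<alpha>"
    using H o T0 unfolding ZC3_def C3_def H_at_def by (fastforce simp: simplex3_def)
  have "sobolev_norm \<alpha> (H_at H T0 n k) \<le> enn2real (C3_norm \<gamma> \<alpha> T H) * dhalf T0 n k powr \<gamma>"
    unfolding H_at_def midpt_minus[symmetric]
    by (rule ZC3_equidistant_bound[OF H])
       (use o T0 midpt_minus[of T0 n k] in \<open>auto simp: dhalf_def\<close>)
  also have "\<dots> \<le> enn2real (C3_norm \<gamma> \<alpha> T H) * dlen T0 n k powr \<gamma>"
    using T0 \<open>0 < \<gamma>\<close> by (intro mult_left_mono powr_mono2) (auto simp: dlen_eq dhalf_eq field_simps)
  finally show "sobolev_norm \<alpha> (H_at H T0 n k) \<le> enn2real (C3_norm \<gamma> \<alpha> T H) * dlen T0 n k powr \<gamma>" .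
qed

section \<open>The recursion in terms of residuals\<close>

text \<open>
  The prescribed end value of the path makes the first residual vanish, which starts the induction
  for Sobolev membership.
\<close>

lemma heat_residual_root: "heat_residual c0 \<sigma> T H 0 0 = 0"
  by (simp add: heat_residual_def remainder_def dyadic_def heat_def spectral_def zero_fun_def
      plus_fun_def fun_diff_def)

lemma heat_path_midpoint:
  "heat_path c0 \<sigma> T H (Suc n) (Suc (2 * k)) =
    BH H (midpt T n k) (dyadic T n k) + heat (dhalf T n k) (heat_path c0 \<sigma> T H n k)
      - heat_left c0 \<sigma> T H n k"
  by (simp add: Let_def heat_left_def heat_Y_def heat_residual_def midpt_minus)

lemma heat_residual_left: "heat_residual c0 \<sigma> T H (Suc n) (2 * k) = heat_left c0 \<sigma> T H n k"
proof -
  have 1: "heat_path c0 \<sigma> T H (Suc n) (2 * k) = heat_path c0 \<sigma> T H n k"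
    by simp
  show ?thesis
    unfolding heat_residual_def remainder_def add_0_right Suc_eq_plus1[symmetric]
      dyadic_Suc_even dyadic_Suc_odd midpt_minus heat_path_midpoint 1
    by simp
qed

text \<open>
  Write \<open>a < b < c\<close> for the parent interval with its midpoint.  Inserting the value of the path at
  \<open>b\<close> gives the parent residual minus the left child transported by the heat flow, up to
  \<open>H c a 0 - H c b 0 - heat h (H b a 0)\<close>.  By the cocycle identity at \<open>(c, b, a, 0)\<close> this is
  \<open>- H c b a\<close>, so that the result is \<open>Y\<close> minus the transported left child.
\<close>

lemma heat_residual_right:
  assumes H: "H \<in> ZC3 \<gamma> \<alpha> T" and T0: "0 < T0" "T0 \<le> T" and k: "k < 2 ^ n"
  shows "heat_residual c0 \<sigma> T0 H (Suc n) (Suc (2 * k)) = heat_right c0 \<sigma> T0 H n k"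
proof -
  define a b c h where "a = dyadic T0 n k" and "b = midpt T0 n k" and "c = dyadic T0 n (Suc k)"
    and "h = dhalf T0 n k"
  note ds = a_def[symmetric] b_def[symmetric] c_def[symmetric] h_def[symmetric]
  define Ia Ic Ql where "Ia = heat_path c0 \<sigma> T0 H n k" and "Ic = heat_path c0 \<sigma> T0 H n (Suc k)"
    and "Ql = heat_left c0 \<sigma> T0 H n k"
  have cb: "c - b = h" and ba: "b - a = h" and ca: "c - a = h + h"
    using midpt_minus[of T0 n k] by (auto simp: a_def b_def c_def h_def dhalf_def)
  have ends: "heat_path c0 \<sigma> T0 H (Suc n) (Suc (Suc (2 * k))) = Ic"
    by (simp add: Ic_def)
  have Q: "heat_residual c0 \<sigma> T0 H (Suc n) (Suc (2 * k)) =
      - H c b 0 - Ic + heat h (- H b a 0 + heat h Ia - Ql)"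
    unfolding heat_residual_def remainder_def Suc_eq_plus1[symmetric] dyadic_Suc_odd
      dyadic_Suc_odd_right heat_path_midpoint ends
    by (simp add: ds cb BH_def Ia_def Ql_def)
  have P: "heat_residual c0 \<sigma> T0 H n k = - H c a 0 - Ic + heat h (heat h Ia)"
    using heat_add[of h h Ia]
    by (simp add: heat_residual_def remainder_def ds ca BH_def Ia_def Ic_def)
  have "delta_hat H c b a 0 = 0"
    using H dyadic_order[OF T0(1) k] T0 by (simp add: ZC3_def a_def b_def c_def)
  then have cocycle: "H c b a = H c b 0 - H c a 0 + heat h (H b a 0)"
    by (simp add: delta_hat_def cb algebra_simps)
  have lin: "heat h (- x + y - z) = - heat h x + heat h y - heat h z" for x y z :: "'a torus_dist"
    by (simp add: heat_def spectral_def fun_eq_iff algebra_simps)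
  have Y: "heat_Y c0 \<sigma> T0 H n k = heat_residual c0 \<sigma> T0 H n k - H c b a"
    by (simp add: heat_Y_def H_at_def ds)
  have "heat_residual c0 \<sigma> T0 H (Suc n) (Suc (2 * k)) + heat h Ql = heat_Y c0 \<sigma> T0 H n k"
    unfolding Q P Y lin cocycle by (simp add: algebra_simps)
  moreover have "heat_right c0 \<sigma> T0 H n k + heat h Ql = heat_Y c0 \<sigma> T0 H n k"
    unfolding Ql_def heat_right_def heat_left_def h_def by (rule split_reconstruct)
  ultimately show ?thesis
    by (metis add_right_cancel)
qed

lemma heat_residual_sobolev:
  assumes H: "H \<in> ZC3 \<gamma> \<alpha> T" and T0: "0 < T0" "T0 \<le> T" "T0 \<le> 1"
    and par: "0 < \<gamma>" "\<sigma> < 1" "0 < c0"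
  shows "k < 2 ^ n \<Longrightarrow> heat_residual c0 \<sigma> T0 H n k \<in> sobolev \<alpha>"
proof (induction n arbitrary: k)
  case 0
  then have "k = 0" by simp
  then show ?case
    using heat_residual_root sobolev_zero by metis
next
  case (Suc n)
  define j where "j = k div 2"
  have j: "j < 2 ^ n"
    using Suc.prems by (simp add: j_def less_mult_imp_div_less mult.commute)
  have Y: "heat_Y c0 \<sigma> T0 H n j \<in> sobolev \<alpha>"
    unfolding heat_Y_def
    using Suc.IH[OF j] H_at_bounded[OF H T0(1,2) j par(1)] by (intro sobolev_diff) auto
  have "T0 \<le> 2 ^ Suc n"
    using T0(3) by (rule order_trans) (rule one_le_power, simp)
  then have h: "0 < dhalf T0 n j" "dhalf T0 n j \<le> 1"
    using T0 by (auto simp: dhalf_eq field_simps)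
  consider "k = 2 * j" | "k = Suc (2 * j)"
    unfolding j_def by linarith
  then show ?case
  proof cases
    case 1
    then show ?thesis
      using split_left_bounded[OF Y h par(2,3)] by (simp add: heat_residual_left heat_left_def)
  next
    case 2
    then show ?thesis
      using split_right_bounded[OF Y]
      by (simp add: heat_residual_right[OF H T0(1,2) j] heat_right_def)
  qed
qed

lemma heat_scale_splitting:
  assumes H: "H \<in> ZC3 \<gamma> \<alpha> T" and T0: "0 < T0" "T0 \<le> T" "T0 \<le> 1"
    and par: "0 < \<gamma>" "\<sigma> < 1" "0 < c0"
  shows "scale_splitting \<alpha> T0 H (heat_residual c0 \<sigma> T0 H)"
  unfolding scale_splitting_def
proof (intro allI impI conjI)
  fix n k :: nat
  assume k: "k < 2 ^ n"
  show "heat_residual c0 \<sigma> T0 H n k \<in> sobolev \<alpha>"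
    by (rule heat_residual_sobolev[OF H T0 par k])
  have "heat_right c0 \<sigma> T0 H n k + heat (dhalf T0 n k) (heat_left c0 \<sigma> T0 H n k)
      = heat_Y c0 \<sigma> T0 H n k"
    unfolding heat_right_def heat_left_def by (rule split_reconstruct)
  then show "heat_residual c0 \<sigma> T0 H n k = heat_residual c0 \<sigma> T0 H (n + 1) (2 * k + 1)
      + heat (dhalf T0 n k) (heat_residual c0 \<sigma> T0 H (n + 1) (2 * k)) + H_at H T0 n k"
    by (simp add: heat_residual_left heat_residual_right[OF H T0(1,2) k] heat_Y_def)
qed

section \<open>The two child estimates\<close>

text \<open>
  The tail constant bounds a norm on the root interval; its sign is needed to absorb it into the
  constants.
\<close>

lemma tail_constant_nonneg:
  assumes "0 < T" "parabolic_tail \<gamma> \<alpha> c0 \<beta> \<sigma> K T H"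
  shows "0 \<le> K"
proof -
  have "0 \<le> sobolev_norm \<alpha> (P_gt c0 (cutoff \<sigma> (dhalf T 0 0)) (heat_Y c0 \<sigma> T H 0 0))"
    by (rule sobolev_norm_nonneg)
  also have "\<dots> \<le> K * dlen T 0 0 powr (\<gamma> + \<sigma> * \<beta> / 2)"
    using assms(2) by (simp add: parabolic_tail_def)
  finally show ?thesis
    using assms(1) by (simp add: dlen_eq zero_le_mult_iff)
qed

text \<open>
  The norm of \<open>H\<close> is taken on the full horizon \<open>T\<close> while the recursion runs on \<open>T0 \<le> T\<close>, so that the
  same constant serves all restricted horizons.  The excess \<open>c0 exp c0 / 2\<close> of the left symbol and the
  factor \<open>1\<close> in front of the tail determine the constant.
\<close>

lemma heat_children_bound:
  assumes H: "H \<in> ZC3 \<gamma> \<alpha> T" and T0: "0 < T0" "T0 \<le> T" "T0 \<le> 1"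
    and par: "0 < \<gamma>" "0 < \<sigma>" "\<sigma> < 1" "0 < \<beta>" "0 < c0"
    and tail: "parabolic_tail \<gamma> \<alpha> c0 \<beta> \<sigma> K T0 H" and k: "k < 2 ^ n"
    and \<eta>: "0 < \<eta>" "\<eta> \<le> 1 - \<sigma>"
  defines "C \<equiv> 1 + c0 * exp c0"
  shows "max (sobolev_norm \<alpha> (heat_right c0 \<sigma> T0 H n k)) (sobolev_norm \<alpha> (heat_left c0 \<sigma> T0 H n k))
    \<le> (1 / 2 + C * dlen T0 n k powr \<eta>) * sobolev_norm \<alpha> (heat_residual c0 \<sigma> T0 H n k)
      + C * (enn2real (C3_norm \<gamma> \<alpha> T H) + K) * dlen T0 n k powr \<gamma>"
proof -
  define L h where "L = dlen T0 n k" and "h = dhalf T0 n k"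
  define Y Q M where "Y = heat_Y c0 \<sigma> T0 H n k" and "Q = sobolev_norm \<alpha> (heat_residual c0 \<sigma> T0 H n k)"
    and "M = enn2real (C3_norm \<gamma> \<alpha> T H)"
  define D where "D = c0 * exp c0"
  have D: "0 < D" and CD: "C = 1 + D"
    using par by (simp_all add: D_def C_def)
  have "T0 \<le> 2 ^ n"
    using T0(3) by (rule order_trans) (rule one_le_power, simp)
  then have L: "0 < L" "L \<le> 1" and h: "0 < h" "h \<le> L"
    using T0 by (auto simp: L_def h_def dlen_eq dhalf_eq field_simps)
  have M: "0 \<le> M" and Q: "0 \<le> Q"
    by (simp_all add: M_def Q_def sobolev_norm_nonneg)
  have K: "0 \<le> K"
    by (rule tail_constant_nonneg[OF T0(1) tail])
  note res = heat_residual_sobolev[OF H T0 par(1,3,5) k]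
  note Hb = H_at_bounded[OF H T0(1,2) k par(1)]
  have Ys: "Y \<in> sobolev \<alpha>"
    unfolding Y_def heat_Y_def using res Hb by (intro sobolev_diff) auto
  have Yn: "sobolev_norm \<alpha> Y \<le> Q + M * L powr \<gamma>"
    using sobolev_norm_diff_le[OF res Hb[THEN conjunct1]] Hb
    by (simp add: Y_def heat_Y_def Q_def M_def L_def)
  have L\<eta>: "0 \<le> L powr \<eta>" "L powr \<eta> \<le> 1"
    using L \<eta> by (auto intro: powr_le1)
  have L\<gamma>: "0 \<le> L powr \<gamma>" by simp
  have hL: "h powr (1 - \<sigma>) \<le> L powr \<eta>"
  proof -
    have "h powr (1 - \<sigma>) \<le> L powr (1 - \<sigma>)"
      using h par by (intro powr_mono2) auto
    also have "\<dots> \<le> L powr \<eta>"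
      using L \<eta> by (intro powr_mono') auto
    finally show ?thesis .
  qed
  let ?R = "(1 / 2 + C * L powr \<eta>) * Q + C * (M + K) * L powr \<gamma>"
  have "sobolev_norm \<alpha> (split_left c0 \<sigma> h Y)
      \<le> (1 / 2 + D / 2 * h powr (1 - \<sigma>)) * sobolev_norm \<alpha> Y"
    using split_left_bounded[OF Ys h(1) _ par(3,5)] h L by (simp add: D_def)
  also have "\<dots> \<le> (1 / 2 + D / 2 * L powr \<eta>) * (Q + M * L powr \<gamma>)"
    using hL Yn D sobolev_norm_nonneg by (intro mult_mono add_mono mult_left_mono) auto
  also have "\<dots> = (1 / 2 + D / 2 * L powr \<eta>) * Q + (1 / 2 + D / 2 * L powr \<eta>) * M * L powr \<gamma>"
    by (simp add: algebra_simps)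
  also have "\<dots> \<le> ?R"
  proof -
    have "D / 2 * L powr \<eta> \<le> C * L powr \<eta>"
      using D L\<eta> by (intro mult_right_mono) (auto simp: CD)
    moreover have "D / 2 * L powr \<eta> \<le> D / 2"
      using D L\<eta> by (intro mult_left_le) auto
    then have "1 / 2 + D / 2 * L powr \<eta> \<le> C"
      using D unfolding CD by linarith
    then have "(1 / 2 + D / 2 * L powr \<eta>) * M \<le> C * (M + K)"
      using D M K by (intro mult_mono) (auto simp: CD)
    ultimately show ?thesis
      by (intro add_mono[OF mult_right_mono[OF _ Q] mult_right_mono[OF _ L\<gamma>]]) linarith+
  qed
  finally have left: "sobolev_norm \<alpha> (split_left c0 \<sigma> h Y) \<le> ?R" .
  have "sobolev_norm \<alpha> (P_gt c0 (cutoff \<sigma> h) Y) \<le> K * L powr (\<gamma> + \<sigma> * \<beta> / 2)"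
    using tail k by (simp add: parabolic_tail_def L_def h_def Y_def)
  also have "\<dots> \<le> K * L powr \<gamma>"
    using K L par by (intro mult_left_mono powr_mono') auto
  finally have high: "sobolev_norm \<alpha> (P_gt c0 (cutoff \<sigma> h) Y) \<le> K * L powr \<gamma>" .
  have "sobolev_norm \<alpha> (split_right c0 \<sigma> h Y)
      \<le> 1 / 2 * sobolev_norm \<alpha> Y + sobolev_norm \<alpha> (P_gt c0 (cutoff \<sigma> h) Y)"
    using split_right_bounded[OF Ys] by blast
  also have "\<dots> \<le> 1 / 2 * (Q + M * L powr \<gamma>) + K * L powr \<gamma>"
    using Yn high by (intro add_mono mult_left_mono) auto
  also have "\<dots> = 1 / 2 * Q + (1 / 2 * M + K) * L powr \<gamma>"
    by (simp add: algebra_simps)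
  also have "\<dots> \<le> ?R"
  proof -
    have "0 \<le> D * M" "0 \<le> D * K" using D M K by auto
    then have "1 / 2 * M + K \<le> C * (M + K)"
      using M by (simp add: CD algebra_simps)
    moreover have "0 \<le> C * L powr \<eta>"
      using D by (simp add: CD)
    ultimately show ?thesis
      by (intro add_mono[OF mult_right_mono[OF _ Q] mult_right_mono[OF _ L\<gamma>]]) linarith+
  qed
  finally have right: "sobolev_norm \<alpha> (split_right c0 \<sigma> h Y) \<le> ?R" .
  show ?thesis
    using left right
    by (simp add: heat_left_def heat_right_def L_def h_def Y_def Q_def M_def)
qed

section \<open>Restriction to a shorter horizon\<close>

lemma dyadic_rescale: "dyadic (T / 2 ^ m) n k = dyadic T (n + m) k"
  by (simp add: dyadic_def power_add)

lemma midpt_rescale: "midpt (T / 2 ^ m) n k = midpt T (n + m) k"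
  by (simp add: midpt_def dyadic_rescale)

lemma dhalf_rescale: "dhalf (T / 2 ^ m) n k = dhalf T (n + m) k"
  by (simp add: dhalf_def dyadic_rescale midpt_rescale)

lemma dlen_rescale: "dlen (T / 2 ^ m) n k = dlen T (n + m) k"
  by (simp add: dlen_def dyadic_rescale)

lemma H_at_rescale: "H_at H (T / 2 ^ m) n k = H_at H T (n + m) k"
  by (simp add: H_at_def dyadic_rescale midpt_rescale)

lemma index_shift_less: "k < 2 ^ n \<Longrightarrow> k < 2 ^ (n + m)" for k :: nat
  by (rule less_le_trans) (auto intro: power_increasing)

text \<open>
  At the root the restarted residual is zero, and the original one is a left child with half-length
  \<open>T0\<close>, hence has no coefficient above the cut-off at scale \<open>T0\<close>.  From there on both recursions apply
  the same multipliers and subtract the same values of \<open>H\<close>, so coefficients that agree keep agreeing.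
\<close>

lemma restarted_residual_eq_above_cutoff:
  assumes H: "H \<in> ZC3 \<gamma> \<alpha> T" and T: "0 < T" and T0: "T0 = T / 2 ^ m"
    and high: "c0 * (cutoff \<sigma> T0)\<^sup>2 < A0_eigenvalue j"
  shows "k < 2 ^ n \<Longrightarrow> heat_residual c0 \<sigma> T0 H n k j = heat_residual c0 \<sigma> T H (n + m) k j"
proof (induction n arbitrary: k)
  case 0
  show ?case
  \<comment> \<open>only a proper sub-interval is a left child; for \<open>m = 0\<close> the two recursions coincide\<close>
  proof (cases m)
    case 0
    with T0 show ?thesis by simp
  next
    case (Suc p)
    have "heat_residual c0 \<sigma> T H m 0 = split_left c0 \<sigma> T0 (heat_Y c0 \<sigma> T H p 0)"
      using heat_residual_left[of c0 \<sigma> T H p 0] by (simp add: Suc heat_left_def dhalf_eq T0)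
    then show ?thesis
      using "0.prems" high by (simp add: heat_residual_root split_left_spectral spectral_def)
  qed
next
  case (Suc n)
  have le: "T0 \<le> T"
    using T by (simp add: T0 field_simps)
  have pos: "0 < T0"
    using T by (simp add: T0)
  define i where "i = k div 2"
  have i: "i < 2 ^ n"
    using Suc.prems by (simp add: i_def less_mult_imp_div_less mult.commute)
  have Y: "heat_Y c0 \<sigma> T0 H n i j = heat_Y c0 \<sigma> T H (n + m) i j"
    using Suc.IH[OF i] by (simp add: heat_Y_def T0 H_at_rescale)
  have h: "dhalf T0 n i = dhalf T (n + m) i"
    by (simp add: T0 dhalf_rescale)
  consider "k = 2 * i" | "k = Suc (2 * i)"
    unfolding i_def by linarith
  then show ?case
  proof cases
    case 1
    then show ?thesis
      using Y h by (simp add: heat_residual_left heat_left_def split_left_spectral spectral_def)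
  next
    case 2
    then show ?thesis
      using Y h
      by (simp add: heat_residual_right[OF H pos le i] heat_right_def split_right_def
          heat_residual_right[OF H T order_refl index_shift_less[OF i]]
          half_P_le_spectral P_gt_spectral spectral_def)
  qed
qed

text \<open>
  The cut-off at the half-length of an interval inside \<open>[0, T0]\<close> is at least the cut-off at scale \<open>T0\<close>,
  so the projected quantities of the two recursions coincide and the tail bound carries over with the
  same \<open>K\<close>.
\<close>

lemma parabolic_tail_restart:
  assumes H: "H \<in> ZC3 \<gamma> \<alpha> T" and T: "0 < T" and T0: "T0 = T / 2 ^ m"
    and "0 < \<sigma>" "0 < c0" and tail: "parabolic_tail \<gamma> \<alpha> c0 \<beta> \<sigma> K T H"
  shows "parabolic_tail \<gamma> \<alpha> c0 \<beta> \<sigma> K T0 H"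
  unfolding parabolic_tail_def
proof (intro allI impI)
  fix n k :: nat
  assume k: "k < 2 ^ n"
  let ?N = "cutoff \<sigma> (dhalf T0 n k)"
  have T0p: "0 < T0"
    using T by (simp add: T0)
  have "1 \<le> (2 :: real) ^ Suc n"
    by (rule one_le_power) simp
  then have h: "0 < dhalf T0 n k" "dhalf T0 n k \<le> T0"
    using T0p by (auto simp: dhalf_eq field_simps simp del: power_Suc)
  then have "cutoff \<sigma> T0 \<le> ?N"
    using \<open>0 < \<sigma>\<close> unfolding cutoff_def by (intro powr_mono2') auto
  then have N: "c0 * (cutoff \<sigma> T0)\<^sup>2 \<le> c0 * ?N\<^sup>2"
    using \<open>0 < c0\<close> by (intro mult_left_mono power_mono) (auto simp: cutoff_def)
  have "P_gt c0 ?N (heat_Y c0 \<sigma> T0 H n k) = P_gt c0 ?N (heat_Y c0 \<sigma> T H (n + m) k)"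
  proof
    fix j
    show "P_gt c0 ?N (heat_Y c0 \<sigma> T0 H n k) j = P_gt c0 ?N (heat_Y c0 \<sigma> T H (n + m) k) j"
    proof (cases "A0_eigenvalue j \<le> c0 * ?N\<^sup>2")
      case True
      then show ?thesis by (simp add: P_gt_spectral spectral_def)
    next
      case False
      then have "c0 * (cutoff \<sigma> T0)\<^sup>2 < A0_eigenvalue j"
        using N by linarith
      from restarted_residual_eq_above_cutoff[OF H T T0 this k]
      show ?thesis
        by (simp add: P_gt_spectral spectral_def heat_Y_def T0 H_at_rescale)
    qed
  qed
  moreover have "sobolev_norm \<alpha> (P_gt c0 (cutoff \<sigma> (dhalf T (n + m) k)) (heat_Y c0 \<sigma> T H (n + m) k))
      \<le> K * dlen T (n + m) k powr (\<gamma> + \<sigma> * \<beta> / 2)"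
    using tail index_shift_less[OF k] by (simp add: parabolic_tail_def)
  ultimately show "sobolev_norm \<alpha> (P_gt c0 ?N (heat_Y c0 \<sigma> T0 H n k))
      \<le> K * dlen T0 n k powr (\<gamma> + \<sigma> * \<beta> / 2)"
    by (simp add: T0 dhalf_rescale dlen_rescale)
qed

lemma scale_splitting_shift:
  assumes "scale_splitting \<alpha> T H Q"
  shows "scale_splitting \<alpha> (T / 2 ^ m) H (\<lambda>n. Q (n + m))"
  unfolding scale_splitting_def
proof (intro allI impI)
  fix n k :: nat
  assume "k < 2 ^ n"
  then have k: "k < 2 ^ (n + m)"
    by (rule index_shift_less)
  have shift: "n + 1 + m = n + m + 1" by simp
  show "Q (n + m) k \<in> sobolev \<alpha> \<and> Q (n + m) k =
      Q (n + 1 + m) (2 * k + 1) + heat (dhalf (T / 2 ^ m) n k) (Q (n + 1 + m) (2 * k))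
        + H_at H (T / 2 ^ m) n k"
    unfolding dhalf_rescale H_at_rescale shift
    by (rule assms[unfolded scale_splitting_def, rule_format, OF k])
qed

text \<open>
  Every interval is at most as long as the horizon, so the scale-dependent factor is dominated by its
  value there, which is the admissible \<open>\<theta>\<close>.
\<close>

lemma subcritical_admissibleI:
  assumes "0 < \<gamma>" "\<gamma> < 1" "scale_splitting \<alpha> T H Q" "0 < T" "0 < \<eta>" "0 < C" "0 \<le> CH"
    and small: "1 / 2 + C * T powr \<eta> < 2 powr (- \<gamma>)"
    and bound: "\<And>n k. k < 2 ^ n \<Longrightarrow>
        max (sobolev_norm \<alpha> (Q (Suc n) (Suc (2 * k)))) (sobolev_norm \<alpha> (Q (Suc n) (2 * k)))
          \<le> (1 / 2 + C * dlen T n k powr \<eta>) * sobolev_norm \<alpha> (Q n k) + CH * dlen T n k powr \<gamma>"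
  shows "subcritical_admissible \<gamma> \<alpha> T H Q"
  unfolding subcritical_admissible_def
proof (intro conjI exI allI impI)
  show "0 \<le> 1 / 2 + C * T powr \<eta>"
    using \<open>0 < C\<close> by simp
  fix n k :: nat
  assume k: "k < 2 ^ n"
  have "1 \<le> (2 :: real) ^ n"
    by (rule one_le_power) simp
  then have "dlen T n k powr \<eta> \<le> T powr \<eta>"
    using \<open>0 < T\<close> \<open>0 < \<eta>\<close> by (intro powr_mono2) (auto simp: dlen_eq field_simps)
  then have "(1 / 2 + C * dlen T n k powr \<eta>) * sobolev_norm \<alpha> (Q n k)
      \<le> (1 / 2 + C * T powr \<eta>) * sobolev_norm \<alpha> (Q n k)"
    using \<open>0 < C\<close> sobolev_norm_nonneg by (intro mult_right_mono) auto
  with bound[OF k]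
  show "max (sobolev_norm \<alpha> (Q (n + 1) (2 * k + 1))) (sobolev_norm \<alpha> (Q (n + 1) (2 * k)))
      \<le> (1 / 2 + C * T powr \<eta>) * sobolev_norm \<alpha> (Q n k) + CH * dlen T n k powr \<gamma>"
    by simp
qed (use assms in auto)

theorem proposition7p5:
  fixes \<gamma> \<alpha> T \<sigma> \<beta> c0 \<rho> \<eta> :: real
  assumes "0 < \<gamma>" "\<gamma> \<le> 1" "0 < T" "T \<le> 1" "0 < \<sigma>" "\<sigma> < 1" "0 < \<beta>" "0 < c0"
    and "\<rho> = \<sigma> * \<beta> / 2" and "\<eta> = min (1 - \<sigma>) \<rho>"
  shows "\<exists>C>0. \<forall>(H :: 'd::finite incr) K.
    H \<in> ZC3 \<gamma> \<alpha> T \<and> parabolic_tail \<gamma> \<alpha> c0 \<beta> \<sigma> K T H \<longrightarrow>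
      (\<forall>n. \<forall>k<2 ^ n.
        max (sobolev_norm \<alpha> (heat_right c0 \<sigma> T H n k)) (sobolev_norm \<alpha> (heat_left c0 \<sigma> T H n k))
          \<le> (1 / 2 + C * dlen T n k powr \<eta>) * sobolev_norm \<alpha> (heat_residual c0 \<sigma> T H n k)
            + C * (enn2real (C3_norm \<gamma> \<alpha> T H) + K) * dlen T n k powr \<gamma>)
      \<and> (\<gamma> = 1 \<longrightarrow> critical_admissible \<alpha> T H (heat_residual c0 \<sigma> T H))
      \<and> (\<gamma> < 1 \<longrightarrow> (\<forall>T0. 0 < T0 \<and> T0 \<le> T \<and> 1 / 2 + C * T0 powr \<eta> < 2 powr (- \<gamma>) \<longrightarrow>
          (parabolic_tail \<gamma> \<alpha> c0 \<beta> \<sigma> K T0 H \<or> (\<exists>m. T0 = T / 2 ^ m) \<longrightarrow>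
             subcritical_admissible \<gamma> \<alpha> T0 H (heat_residual c0 \<sigma> T0 H))
          \<and> (\<forall>m. T0 = T / 2 ^ m \<longrightarrow>
             subcritical_admissible \<gamma> \<alpha> T0 H (\<lambda>n. heat_residual c0 \<sigma> T H (n + m)))))"
proof -
  define C where "C = 1 + c0 * exp c0"
  have C: "0 < C"
    using \<open>0 < c0\<close> by (simp add: C_def add_pos_pos)
  have "0 < \<rho>"
    using \<open>0 < \<sigma>\<close> \<open>0 < \<beta>\<close> by (simp add: \<open>\<rho> = _\<close>)
  then have \<eta>: "0 < \<eta>" "\<eta> \<le> 1 - \<sigma>"
    using \<open>\<sigma> < 1\<close> by (auto simp: \<open>\<eta> = _\<close>)
  have main: "max (sobolev_norm \<alpha> (heat_right c0 \<sigma> T0 H n k)) (sobolev_norm \<alpha> (heat_left c0 \<sigma> T0 H n k))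
      \<le> (1 / 2 + C * dlen T0 n k powr \<eta>) * sobolev_norm \<alpha> (heat_residual c0 \<sigma> T0 H n k)
        + C * (enn2real (C3_norm \<gamma> \<alpha> T H) + K) * dlen T0 n k powr \<gamma>"
    if "H \<in> ZC3 \<gamma> \<alpha> T" "parabolic_tail \<gamma> \<alpha> c0 \<beta> \<sigma> K T0 H" "0 < T0" "T0 \<le> T" "k < 2 ^ n"
    for H :: "'d incr" and K T0 n k
    unfolding C_def using that assms \<eta> by (intro heat_children_bound) auto
  show ?thesis
  proof (intro exI[of _ C] conjI allI impI C; (elim conjE)?)
    fix H :: "'d incr" and K
    assume H: "H \<in> ZC3 \<gamma> \<alpha> T" and tail: "parabolic_tail \<gamma> \<alpha> c0 \<beta> \<sigma> K T H"
    define M where "M = C * (enn2real (C3_norm \<gamma> \<alpha> T H) + K)"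
    have M: "0 \<le> M"
      using tail_constant_nonneg[OF \<open>0 < T\<close> tail] C by (simp add: M_def)
    have split: "scale_splitting \<alpha> T0 H (heat_residual c0 \<sigma> T0 H)" if "0 < T0" "T0 \<le> T" for T0
      using that assms by (intro heat_scale_splitting[OF H]) auto
    have children: "max (sobolev_norm \<alpha> (heat_residual c0 \<sigma> T0 H (Suc n) (Suc (2 * k))))
        (sobolev_norm \<alpha> (heat_residual c0 \<sigma> T0 H (Suc n) (2 * k)))
      \<le> (1 / 2 + C * dlen T0 n k powr \<eta>) * sobolev_norm \<alpha> (heat_residual c0 \<sigma> T0 H n k)
        + M * dlen T0 n k powr \<gamma>"
      if "parabolic_tail \<gamma> \<alpha> c0 \<beta> \<sigma> K T0 H" "0 < T0" "T0 \<le> T" "k < 2 ^ n" for T0 n k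
      unfolding heat_residual_left heat_residual_right[OF H that(2-4)] M_def
      by (rule main[OF H that])
    {
      fix n k :: nat
      assume "k < 2 ^ n"
      then show "max (sobolev_norm \<alpha> (heat_right c0 \<sigma> T H n k)) (sobolev_norm \<alpha> (heat_left c0 \<sigma> T H n k))
          \<le> (1 / 2 + C * dlen T n k powr \<eta>) * sobolev_norm \<alpha> (heat_residual c0 \<sigma> T H n k)
            + C * (enn2real (C3_norm \<gamma> \<alpha> T H) + K) * dlen T n k powr \<gamma>"
        by (rule main[OF H tail \<open>0 < T\<close> order_refl])
    }
    {
      assume "\<gamma> = 1"
      \<comment> \<open>\<open>M + 1\<close> because criticality asks for a positive constant, and \<open>M\<close> may vanish\<close>
      have "max (sobolev_norm \<alpha> (heat_residual c0 \<sigma> T H (n + 1) (2 * k + 1)))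
          (sobolev_norm \<alpha> (heat_residual c0 \<sigma> T H (n + 1) (2 * k)))
        \<le> (1 / 2 + C * dlen T n k powr \<eta>) * sobolev_norm \<alpha> (heat_residual c0 \<sigma> T H n k)
          + (M + 1) * dlen T n k" if "k < 2 ^ n" for n k
      proof -
        have "0 < dlen T n k"
          using \<open>0 < T\<close> by (simp add: dlen_eq)
        then show ?thesis
          using children[OF tail \<open>0 < T\<close> order_refl that] \<open>\<gamma> = 1\<close>
          by (simp add: distrib_right)
      qed
      then show "critical_admissible \<alpha> T H (heat_residual c0 \<sigma> T H)"
        unfolding critical_admissible_def
        using split[OF \<open>0 < T\<close> order_refl] M C \<eta>(1)
        by (intro conjI exI[of _ "M + 1"] exI[of _ C] exI[of _ \<eta>]) auto
    }
    fix T0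
    assume "\<gamma> < 1" and T0: "0 < T0" "T0 \<le> T" and small: "1 / 2 + C * T0 powr \<eta> < 2 powr (- \<gamma>)"
    {
      assume "parabolic_tail \<gamma> \<alpha> c0 \<beta> \<sigma> K T0 H \<or> (\<exists>m. T0 = T / 2 ^ m)"
      then have tail0: "parabolic_tail \<gamma> \<alpha> c0 \<beta> \<sigma> K T0 H"
        using parabolic_tail_restart[OF H \<open>0 < T\<close> _ \<open>0 < \<sigma>\<close> \<open>0 < c0\<close> tail] by auto
      show "subcritical_admissible \<gamma> \<alpha> T0 H (heat_residual c0 \<sigma> T0 H)"
        by (rule subcritical_admissibleI[OF \<open>0 < \<gamma>\<close> \<open>\<gamma> < 1\<close> split[OF T0] T0(1) \<eta>(1) C M small
              children[OF tail0 T0]])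
    }
    {
      fix m
      assume m: "T0 = T / 2 ^ m"
      have split_m: "scale_splitting \<alpha> T0 H (\<lambda>n. heat_residual c0 \<sigma> T H (n + m))"
        unfolding m by (rule scale_splitting_shift[OF split[OF \<open>0 < T\<close> order_refl]])
      show "subcritical_admissible \<gamma> \<alpha> T0 H (\<lambda>n. heat_residual c0 \<sigma> T H (n + m))"
      proof (rule subcritical_admissibleI[OF \<open>0 < \<gamma>\<close> \<open>\<gamma> < 1\<close> split_m T0(1) \<eta>(1) C M small])
        fix n k :: nat
        assume "k < 2 ^ n"
        from children[OF tail \<open>0 < T\<close> order_refl index_shift_less[OF this, of m]]
        show "max (sobolev_norm \<alpha> (heat_residual c0 \<sigma> T H (Suc n + m) (Suc (2 * k))))
            (sobolev_norm \<alpha> (heat_residual c0 \<sigma> T H (Suc n + m) (2 * k)))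
          \<le> (1 / 2 + C * dlen T0 n k powr \<eta>) * sobolev_norm \<alpha> (heat_residual c0 \<sigma> T H (n + m) k)
            + M * dlen T0 n k powr \<gamma>"
          by (simp add: m dlen_rescale)
      qed
    }
  qed
qed

end
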